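(* If $\mathfrak A$ is a weakly Radon-Nikod\'ym (WRN) Boolean algebra then every subalgebra $\mathfrak B\subseteq\mathfrak A$ is WRN too.
   Context: A family $\{a_i:i\in I\}$ in a Boolean algebra is independent if $\bigcap_{i\in I'}a_i\cap\bigcap_{i\in I''}a_i^c\neq 0$ for all finite disjoint $I',I''\subseteq I$. A Boolean algebra $\mathfrak A$ is WRN if there is a family $\mathcal G\subseteq\mathfrak A$ generating $\mathfrak A$ such that $\mathcal G=\bigcup_{n}\mathcal G_n$ (countable union), where for every $n$ the family $\mathcal G_n$ contains no infinite independent sequence. *)

theory Defs
  imports Main "HOL.Hull"
begin

text \<open>
  Boolean algebras are represented by their carriers: sets of elements of a type of class
  \<open>boolean_algebra\<close> that contain the bounds and are closed under the operations. The whole type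
  \<open>UNIV\<close> is such a carrier.
\<close>

definition boolean_subalgebra :: "'a::boolean_algebra set \<Rightarrow> bool" where
  "boolean_subalgebra A \<longleftrightarrow>
     bot \<in> A \<and> top \<in> A \<and>
     (\<forall>x\<in>A. - x \<in> A) \<and>
     (\<forall>x\<in>A. \<forall>y\<in>A. inf x y \<in> A) \<and>
     (\<forall>x\<in>A. \<forall>y\<in>A. sup x y \<in> A)"

text \<open>\<open>Inf_fin\<close> is unspecified on the empty set; inserting \<open>top\<close> makes the empty meet \<open>top\<close>.\<close>

definition finite_meet :: "('i \<Rightarrow> 'a::boolean_algebra) \<Rightarrow> 'i set \<Rightarrow> 'a" where
  "finite_meet a I = Inf_fin (insert top (a ` I))"

definition independent_family :: "('i \<Rightarrow> 'a::boolean_algebra) \<Rightarrow> 'i set \<Rightarrow> bool" where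
  "independent_family a I \<longleftrightarrow>
     (\<forall>I' I''. finite I' \<and> finite I'' \<and> I' \<subseteq> I \<and> I'' \<subseteq> I \<and> I' \<inter> I'' = {} \<longrightarrow>
        inf (finite_meet a I') (finite_meet (\<lambda>i. - a i) I'') \<noteq> bot)"

text \<open>
  The terms of an independent sequence are automatically pairwise distinct
  (take \<open>I' = {i}\<close> and \<open>I'' = {j}\<close>), so injectivity need not be required.
  The hull is the least subalgebra containing \<open>G\<close>.
\<close>

definition weakly_radon_nikodym :: "'a::boolean_algebra set \<Rightarrow> bool" where
  "weakly_radon_nikodym A \<longleftrightarrow>
     (\<exists>(G :: 'a set) (Gs :: nat \<Rightarrow> 'a set).
        G \<subseteq> A \<and> boolean_subalgebra hull G = A \<and> G = (\<Union>n. Gs n) \<and>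
        (\<forall>n. \<not> (\<exists>a :: nat \<Rightarrow> 'a. range a \<subseteq> Gs n \<and> independent_family a UNIV)))"

end

theory Submission
  imports Defs "HOL-Library.Infinite_Set"
begin

text \<open>
  The property WRN is hereditary because the definition of WRN can be strengthened for free: if a
  Boolean algebra is generated by a countable union of families without infinite independent
  sequences, then the whole algebra is a countable union of such families
  (\<open>weakly_radon_nikodym_covering\<close>). Intersecting the pieces with a subalgebra \<open>B\<close> yields a
  decomposition of \<open>B\<close> itself, and \<open>B\<close> generates \<open>B\<close>.

  The strengthening holds because the property of having no independent sequence survives finite
  unions, complements and pairwise meets, so it passes to the elements obtained from finitely many
  of the given families in a bounded number of steps. Only meets are difficult: an independent
  sequence of meets \<open>s k \<sqinter> t k\<close> does not visibly produce an independent sequence of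
  \<open>s k\<close>'s or \<open>t k\<close>'s. Here Rosenthal's dichotomy helps (\<open>rosenthal_dichotomy\<close>): every
  sequence has an infinite set of indices along which it is independent or along which it converges
  at every ultrafilter, that is, its membership in each ultrafilter is eventually constant.
  If the \<open>s k\<close> and the \<open>t k\<close> come from families without independent sequences, both converge
  along a common infinite set of indices; hence so do the meets, whereas an independent sequence
  never converges.

  Rosenthal's dichotomy in turn is an instance of a Ramsey theorem for infinite subsets of
  \<open>\<nat>\<close> (\<open>ramsey_open\<close>), applied to the sets of indices along which some ultrafilter
  alternately contains and misses the terms of the sequence. That theorem applies because, by
  compactness, such an ultrafilter exists for an infinite set of indices as soon as one exists for
  each of its finite initial segments. If all subsets of some infinite set are of this kind, then
  the terms at every other index in it are independent; if no infinite subset is, the sequence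
  converges along it.
\<close>

section \<open>A Ramsey theorem for infinite sets of natural numbers\<close>

text \<open>
  This is a diagonal construction. The elements of \<open>M\<close> are picked in increasing order, and after each
  choice the reservoir of later elements is shrunk so as to serve all the finitely many sets of
  elements up to that point. A finite \<open>s \<subseteq> M\<close> is thus served by the reservoir reached at its maximum,
  and the part of \<open>M\<close> above \<open>s\<close> lies in that reservoir.
\<close>

lemma fusion:
  fixes Q :: "nat set \<Rightarrow> nat set \<Rightarrow> bool"
  assumes M0: "infinite M0"
    and hereditary: "\<And>s M N. finite s \<Longrightarrow> Q s M \<Longrightarrow> infinite N \<Longrightarrow>
                  {k\<in>N. \<forall>j\<in>s. j < k} \<subseteq> M \<Longrightarrow> Q s N"
    and dense: "\<And>s M. finite s \<Longrightarrow> s \<subseteq> M0 \<Longrightarrow> infinite M \<Longrightarrow> M \<subseteq> M0 \<Longrightarrow>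
                  \<exists>N\<subseteq>M. infinite N \<and> Q s N"
  shows "\<exists>M\<subseteq>M0. infinite M \<and> (\<forall>s\<subseteq>M. finite s \<longrightarrow> Q s M)"
proof -
  have dense_finite: "\<exists>N\<subseteq>M. infinite N \<and> (\<forall>s\<in>S. Q s N)"
    if "finite S" "S \<subseteq> {s. finite s \<and> s \<subseteq> M0}" "infinite M" "M \<subseteq> M0" for S M
    using that
  proof (induction S)
    case empty
    then show ?case by auto
  next
    case (insert s S)
    then obtain N where N: "N \<subseteq> M" "infinite N" "\<forall>s\<in>S. Q s N" by auto
    then obtain N' where N': "N' \<subseteq> N" "infinite N'" "Q s N'"
      using dense[of s N] insert.prems by auto
    have "Q r N'" if "r \<in> S" for r
    proof (rule hereditary)
      show "finite r" using insert.prems(1) that by auto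
      show "Q r N" using N(3) that by blast
    qed (use N' in auto)
    then show ?case using N N' by (metis insert_iff order_trans)
  qed
  \<comment> \<open>the states of the construction: the element picked last and the current reservoir\<close>
  define good where "good = (\<lambda>p :: nat \<times> nat set. snd p \<subseteq> M0 \<and> infinite (snd p) \<and>
      (\<forall>k\<in>snd p. fst p < k) \<and> (\<forall>s. s \<subseteq> M0 \<inter> {..fst p} \<longrightarrow> Q s (snd p)))"
  have good_above: "\<exists>Y\<subseteq>X. good (m, Y)" if "infinite X" "X \<subseteq> M0" for m X
  proof -
    have "infinite (X - {..m})" using that by (simp add: Diff_infinite_finite)
    moreover have "finite (Pow (M0 \<inter> {..m}))" by simp
    moreover have "Pow (M0 \<inter> {..m}) \<subseteq> {s. finite s \<and> s \<subseteq> M0}"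
      by (auto intro: finite_subset)
    moreover have "X - {..m} \<subseteq> M0" using that by blast
    ultimately obtain Y where Y: "Y \<subseteq> X - {..m}" "infinite Y" "\<forall>s\<in>Pow (M0 \<inter> {..m}). Q s Y"
      using dense_finite[of "Pow (M0 \<inter> {..m})" "X - {..m}"] by metis
    then have "good (m, Y)" using that by (auto simp: good_def)
    then show ?thesis using Y by blast
  qed
  define succ where
    "succ = (\<lambda>(q :: nat \<times> nat set) (r :: nat \<times> nat set). fst r \<in> snd q \<and> snd r \<subseteq> snd q)"
  have start: "\<exists>q. good q" using good_above[OF M0 order_refl] by blast
  have continue: "\<exists>r. good r \<and> succ q r" if q: "good q" for q
  proof -
    have X: "infinite (snd q)" "snd q \<subseteq> M0" using q unfolding good_def by blast+
    obtain m where "m \<in> snd q" using infinite_imp_nonempty[OF X(1)] by blast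
    moreover obtain Y where "Y \<subseteq> snd q" "good (m, Y)" using good_above[OF X] by blast
    ultimately have "good (m, Y) \<and> succ q (m, Y)" by (simp add: succ_def)
    then show ?thesis by blast
  qed
  obtain p where p: "\<And>n. good (p n)" and step: "\<And>n. succ (p n) (p (Suc n))"
    using dependent_nat_choice[of "\<lambda>_. good" "\<lambda>_. succ", OF start continue] by blast
  define m where "m = (\<lambda>n. fst (p n))"
  define X where "X = (\<lambda>n. snd (p n))"
  have mX: "m (Suc n) \<in> X n" and Xs: "X (Suc n) \<subseteq> X n" for n
    using step[of n] by (auto simp: m_def X_def succ_def)
  have XM0: "X n \<subseteq> M0" and Xm: "k \<in> X n \<Longrightarrow> m n < k"
    and XQ: "s \<subseteq> M0 \<inter> {..m n} \<Longrightarrow> Q s (X n)" for n s k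
    using p[of n] by (auto simp: good_def m_def X_def)
  have m: "strict_mono m" using mX Xm by (auto simp: strict_mono_Suc_iff)
  have Xanti: "X j \<subseteq> X i" if "i \<le> j" for i j
    using lift_Suc_antimono_le[of X, OF Xs that] .
  have later: "m j \<in> X i" if "i < j" for i j
  proof -
    obtain j' where "j = Suc j'" using \<open>i < j\<close> by (cases j) auto
    then show ?thesis using mX[of j'] Xanti[of i j'] that by auto
  qed
  \<comment> \<open>\<open>m 0\<close> is left out: it need not lie in \<open>M0\<close>, and the first reservoir must contain all of \<open>M\<close>
    in order to serve \<open>s = {}\<close>\<close>
  define M where "M = range (\<lambda>n. m (Suc n))"
  have "infinite M"
    unfolding M_def using m by (intro range_inj_infinite) (auto simp: inj_on_def strict_mono_eq)
  moreover have MM0: "M \<subseteq> M0" using mX XM0 by (auto simp: M_def)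
  moreover have "Q s M" if s: "s \<subseteq> M" "finite s" for s
  proof -
    have "\<exists>i. s \<subseteq> {..m i} \<and> {k\<in>M. \<forall>j\<in>s. j < k} \<subseteq> X i"
    proof (cases "s = {}")
      case True
      then show ?thesis using later[of 0] by (auto simp: M_def intro!: exI[of _ 0])
    next
      case False
      then have "Max s \<in> M" using s Max_in by blast
      then obtain i where i: "Max s = m i" by (auto simp: M_def)
      have "{k\<in>M. \<forall>j\<in>s. j < k} \<subseteq> X i"
      proof
        fix k assume k: "k \<in> {k\<in>M. \<forall>j\<in>s. j < k}"
        then obtain j where j: "k = m j" by (auto simp: M_def)
        have "m i < m j" using k j i Max_in[OF s(2) False] by auto
        then show "k \<in> X i" using later m j by (auto simp: strict_mono_less)
      qed
      then show ?thesis using i s by (metis Max_ge atMost_iff subsetI)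
    qed
    then obtain i where "s \<subseteq> {..m i}" "{k\<in>M. \<forall>j\<in>s. j < k} \<subseteq> X i" by blast
    then show ?thesis using hereditary[of s "X i" M] XQ[of s i] s MM0 \<open>infinite M\<close> by blast
  qed
  ultimately show ?thesis by blast
qed

text \<open>
  This notion from the combinatorial forcing of Nash-Williams and Galvin describes the second
  alternative of \<open>ramsey_open\<close> below, relative to a prescribed initial part \<open>s\<close>.
\<close>

definition accepts :: "nat set set \<Rightarrow> nat set \<Rightarrow> nat set \<Rightarrow> bool" where
  "accepts F M s \<longleftrightarrow>
     (\<forall>N\<subseteq>M. infinite N \<and> (\<forall>j\<in>s. \<forall>k\<in>N. j < k) \<longrightarrow> (\<exists>n. (s \<union> N) \<inter> {..<n} \<in> F))"

lemma accepts_mono: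
  assumes "accepts F M s" "{k\<in>N. \<forall>j\<in>s. j < k} \<subseteq> M"
  shows "accepts F N s"
  unfolding accepts_def
proof (intro allI impI)
  fix N' assume "N' \<subseteq> N" and N': "infinite N' \<and> (\<forall>j\<in>s. \<forall>k\<in>N'. j < k)"
  then have "N' \<subseteq> M" using assms(2) by blast
  then show "\<exists>n. (s \<union> N') \<inter> {..<n} \<in> F" using assms(1) N' unfolding accepts_def by blast
qed

text \<open>
  Splitting off the least element of the continuation shows that acceptance of all one-point end
  extensions of \<open>s\<close> gives acceptance of \<open>s\<close>.
\<close>

lemma accepts_if_accepts_extensions:
  assumes "\<And>n. n \<in> M \<Longrightarrow> (\<forall>j\<in>s. j < n) \<Longrightarrow> accepts F M (insert n s)"
  shows "accepts F M s"
  unfolding accepts_def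
proof (intro allI impI)
  fix N assume N: "N \<subseteq> M" "infinite N \<and> (\<forall>j\<in>s. \<forall>k\<in>N. j < k)"
  define n where "n = (LEAST k. k \<in> N)"
  have n: "n \<in> N" using N unfolding n_def by (metis LeastI ex_in_conv finite.emptyI)
  have least: "n \<le> k" if "k \<in> N" for k using that unfolding n_def by (rule Least_le)
  have "accepts F M (insert n s)" using assms n N by blast
  moreover have "N - {n} \<subseteq> M" "infinite (N - {n})" using N by auto
  moreover have "\<forall>j\<in>insert n s. \<forall>k\<in>N - {n}. j < k"
    using N least by (auto simp: le_neq_implies_less)
  ultimately have "\<exists>i. (insert n s \<union> (N - {n})) \<inter> {..<i} \<in> F"
    unfolding accepts_def by blast
  moreover have "insert n s \<union> (N - {n}) = s \<union> N" using n by auto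
  ultimately show "\<exists>i. (s \<union> N) \<inter> {..<i} \<in> F" by simp
qed

text \<open>
  The first fusion makes every finite \<open>s\<close> decided: accepted, or accepted by no smaller infinite
  set. Among decided sets, an unaccepted \<open>s\<close> has only finitely many accepted one-point end
  extensions, for otherwise these extension points would form an infinite set accepting \<open>s\<close>. The
  second fusion discards them, so that non-acceptance, if it holds for the empty set, spreads to all
  finite subsets of \<open>M\<close>. None of these then belongs to \<open>F\<close>, since members of \<open>F\<close> are accepted.
\<close>

theorem ramsey_open:
  fixes F :: "nat set set"
  assumes "infinite M0"
  obtains M where "M \<subseteq> M0" "infinite M" "\<And>s. s \<subseteq> M \<Longrightarrow> finite s \<Longrightarrow> s \<notin> F"
  | M where "M \<subseteq> M0" "infinite M" "\<And>N. N \<subseteq> M \<Longrightarrow> infinite N \<Longrightarrow> \<exists>n. N \<inter> {..<n} \<in> F"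
proof -
  define rejects where "rejects = (\<lambda>M s. \<forall>N\<subseteq>M. infinite N \<longrightarrow> \<not> accepts F N s)"
  have rejects_mono: "rejects N s"
    if "rejects M s" "infinite N" "{k\<in>N. \<forall>j\<in>s. j < k} \<subseteq> M" "finite s" for N M s
    unfolding rejects_def
  proof (intro allI impI notI)
    fix N' assume N': "N' \<subseteq> N" "infinite N'" "accepts F N' s"
    obtain b where b: "\<forall>j\<in>s. j \<le> b" using \<open>finite s\<close> finite_nat_set_iff_bounded_le by auto
    have "infinite (N' - {..b})" using N' by (simp add: Diff_infinite_finite)
    moreover have "N' - {..b} \<subseteq> M" using N' that(3) b by fastforce
    moreover have "accepts F (N' - {..b}) s" using N'(3) by (rule accepts_mono) auto
    ultimately show False using that(1) unfolding rejects_def by blast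
  qed
  have "\<exists>M\<subseteq>M0. infinite M \<and>
      (\<forall>s\<subseteq>M. finite s \<longrightarrow> accepts F M s \<or> rejects M s)"
  proof (rule fusion[OF assms])
    fix s M N
    assume "finite s" "accepts F M s \<or> rejects M s" "infinite N" "{k\<in>N. \<forall>j\<in>s. j < k} \<subseteq> M"
    then show "accepts F N s \<or> rejects N s"
      using accepts_mono rejects_mono by blast
  next
    fix s M :: "nat set" assume "infinite M"
    show "\<exists>N\<subseteq>M. infinite N \<and> (accepts F N s \<or> rejects N s)"
    proof (cases "rejects M s")
      case True
      then show ?thesis using \<open>infinite M\<close> by blast
    next
      case False
      then show ?thesis unfolding rejects_def by blast
    qed
  qed
  then obtain M1 where M1: "M1 \<subseteq> M0" "infinite M1"
    and decided: "\<And>s. s \<subseteq> M1 \<Longrightarrow> finite s \<Longrightarrow> accepts F M1 s \<or> rejects M1 s"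
    by blast
  define Q where "Q = (\<lambda>s M. accepts F M s \<or> (\<forall>n\<in>M. (\<forall>j\<in>s. j < n) \<longrightarrow> rejects M (insert n s)))"
  have "\<exists>M\<subseteq>M1. infinite M \<and> (\<forall>s\<subseteq>M. finite s \<longrightarrow> Q s M)"
  proof (rule fusion[OF M1(2)])
    fix s M N
    assume s: "finite s" and Q: "Q s M" and N: "infinite N" "{k\<in>N. \<forall>j\<in>s. j < k} \<subseteq> M"
    have "rejects N (insert n s)"
      if "rejects M (insert n s)" for n
      using rejects_mono[OF that N(1)] N(2) s by blast
    then show "Q s N" using Q N accepts_mono[of F M s N] unfolding Q_def by blast
  next
    fix s M assume s: "finite s" "s \<subseteq> M1" and M: "infinite M" "M \<subseteq> M1"
    show "\<exists>N\<subseteq>M. infinite N \<and> Q s N"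
    proof (cases "rejects M1 s")
      case False
      then have "accepts F M1 s" using decided s by blast
      then have "accepts F M s" using M by (auto intro: accepts_mono)
      then show ?thesis using M unfolding Q_def by blast
    next
      case True
      define A where "A = {n\<in>M. (\<forall>j\<in>s. j < n) \<and> accepts F M1 (insert n s)}"
      have "finite A"
      proof (rule ccontr)
        assume "infinite A"
        have "accepts F A s"
        proof (rule accepts_if_accepts_extensions)
          fix n assume "n \<in> A"
          then have "accepts F M1 (insert n s)" by (simp add: A_def)
          then show "accepts F A (insert n s)"
            by (rule accepts_mono) (use M in \<open>auto simp: A_def\<close>)
        qed
        moreover have "A \<subseteq> M1" using M by (auto simp: A_def)
        ultimately show False using True \<open>infinite A\<close> unfolding rejects_def by blast
      qed
      have "infinite (M - A)" using M \<open>finite A\<close> by (simp add: Diff_infinite_finite)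
      moreover have "Q s (M - A)"
        unfolding Q_def
      proof (intro disjI2 ballI impI)
        fix n assume n: "n \<in> M - A" "\<forall>j\<in>s. j < n"
        then have "rejects M1 (insert n s)" using decided[of "insert n s"] s M by (auto simp: A_def)
        then show "rejects (M - A) (insert n s)" using M unfolding rejects_def by blast
      qed
      ultimately show ?thesis by blast
    qed
  qed
  then obtain M where M: "M \<subseteq> M1" "infinite M" and QM: "\<And>s. s \<subseteq> M \<Longrightarrow> finite s \<Longrightarrow> Q s M"
    by blast
  show thesis
  proof (cases "accepts F M {}")
    case True
    then have "\<exists>n. N \<inter> {..<n} \<in> F" if "N \<subseteq> M" "infinite N" for N
      using that unfolding accepts_def by fastforce
    then show thesis using that(2) M M1 by blast
  next
    case False
    have notacc: "s \<subseteq> M \<Longrightarrow> \<not> accepts F M s" if "finite s" for s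
      using that
    proof (induction s rule: finite_linorder_max_induct)
      case empty
      then show ?case using False by simp
    next
      case (insert n s)
      then have "rejects M (insert n s)" using QM[of s] unfolding Q_def by auto
      then show ?case using M unfolding rejects_def by blast
    qed
    have "s \<notin> F" if s: "s \<subseteq> M" "finite s" for s
    proof
      assume "s \<in> F"
      have "accepts F M s"
        unfolding accepts_def
      proof (intro allI impI)
        fix N :: "nat set" assume N: "infinite N \<and> (\<forall>j\<in>s. \<forall>k\<in>N. j < k)"
        define n where "n = (LEAST k. k \<in> N)"
        have n: "n \<in> N" using N unfolding n_def by (metis LeastI ex_in_conv finite.emptyI)
        have "n \<le> k" if "k \<in> N" for k using that unfolding n_def by (rule Least_le)
        then have "N \<inter> {..<n} = {}" by (meson disjoint_iff leD lessThan_iff)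
        moreover have "s \<subseteq> {..<n}" using N n by auto
        ultimately have "(s \<union> N) \<inter> {..<n} = s" by blast
        then show "\<exists>n. (s \<union> N) \<inter> {..<n} \<in> F" using \<open>s \<in> F\<close> by metis
      qed
      then show False using notacc s by blast
    qed
    then show thesis using that(1) M M1 by blast
  qed
qed

section \<open>Ultrafilters in Boolean algebras\<close>

definition proper_filter :: "'a::boolean_algebra set \<Rightarrow> bool" where
  "proper_filter U \<longleftrightarrow> top \<in> U \<and> bot \<notin> U \<and> (\<forall>x\<in>U. \<forall>y\<in>U. inf x y \<in> U) \<and>
     (\<forall>x\<in>U. \<forall>y. x \<le> y \<longrightarrow> y \<in> U)"

definition ultrafilter :: "'a::boolean_algebra set \<Rightarrow> bool" where
  "ultrafilter U \<longleftrightarrow> proper_filter U \<and> (\<forall>x. x \<in> U \<or> - x \<in> U)"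

lemma ultrafilter_inf_iff: "ultrafilter U \<Longrightarrow> inf x y \<in> U \<longleftrightarrow> x \<in> U \<and> y \<in> U"
  unfolding ultrafilter_def proper_filter_def by (meson inf_le1 inf_le2)

lemma ultrafilter_compl_iff: "ultrafilter U \<Longrightarrow> - x \<in> U \<longleftrightarrow> x \<notin> U"
  unfolding ultrafilter_def proper_filter_def by (metis inf_compl_bot)

lemma ultrafilter_top: "ultrafilter U \<Longrightarrow> top \<in> U"
  and ultrafilter_bot: "ultrafilter U \<Longrightarrow> bot \<notin> U"
  unfolding ultrafilter_def proper_filter_def by auto

lemma proper_filter_extends_to_ultrafilter:
  fixes F :: "'a::boolean_algebra set"
  assumes "proper_filter F"
  obtains U where "ultrafilter U" "F \<subseteq> U"
proof -
  define \<A> where "\<A> = {U. proper_filter U \<and> F \<subseteq> U}"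
  have "\<exists>U\<in>\<A>. \<forall>V\<in>\<A>. U \<subseteq> V \<longrightarrow> V = U"
  proof (rule subset_Zorn_nonempty)
    show "\<A> \<noteq> {}" using assms by (auto simp: \<A>_def)
  next
    fix \<C> assume \<C>: "\<C> \<noteq> {}" "subset.chain \<A> \<C>"
    then have sub: "\<C> \<subseteq> \<A>" and chain: "\<And>U V. U \<in> \<C> \<Longrightarrow> V \<in> \<C> \<Longrightarrow> U \<subseteq> V \<or> V \<subseteq> U"
      by (auto simp: subset_chain_def)
    have filters: "proper_filter U" "F \<subseteq> U" if "U \<in> \<C>" for U
      using sub that by (auto simp: \<A>_def)
    have "inf x y \<in> \<Union>\<C>" if "x \<in> \<Union>\<C>" "y \<in> \<Union>\<C>" for x y
    proof -
      obtain U V where UV: "U \<in> \<C>" "V \<in> \<C>" "x \<in> U" "y \<in> V" using \<open>x \<in> \<Union>\<C>\<close> \<open>y \<in> \<Union>\<C>\<close> by auto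
      then obtain W where "W \<in> \<C>" "x \<in> W" "y \<in> W" using chain[of U V] by blast
      then show ?thesis using filters[of W] unfolding proper_filter_def by blast
    qed
    moreover have "top \<in> \<Union>\<C>" "bot \<notin> \<Union>\<C>" "F \<subseteq> \<Union>\<C>"
      using \<C>(1) filters unfolding proper_filter_def by blast+
    moreover have "\<forall>x\<in>\<Union>\<C>. \<forall>y. x \<le> y \<longrightarrow> y \<in> \<Union>\<C>"
      using filters unfolding proper_filter_def by blast
    ultimately show "\<Union>\<C> \<in> \<A>" unfolding \<A>_def proper_filter_def by blast
  qed
  then obtain U where U: "proper_filter U" "F \<subseteq> U"
    and maximal: "\<And>V. proper_filter V \<Longrightarrow> F \<subseteq> V \<Longrightarrow> U \<subseteq> V \<Longrightarrow> V = U"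
    by (auto simp: \<A>_def)
  have "- x \<in> U" if "x \<notin> U" for x
  proof -
    \<comment> \<open>the filter generated by \<open>U\<close> and \<open>x\<close>, which is improper by maximality\<close>
    define V where "V = {y. \<exists>u\<in>U. inf u x \<le> y}"
    have "U \<subseteq> V" by (auto simp: V_def intro: le_infI1)
    moreover have "x \<in> V" using U by (auto simp: V_def proper_filter_def)
    ultimately have "\<not> proper_filter V" using maximal U that by blast
    moreover have "inf y z \<in> V" if "y \<in> V" "z \<in> V" for y z
    proof -
      obtain u where u: "u \<in> U" "inf u x \<le> y" using \<open>y \<in> V\<close> by (auto simp: V_def)
      obtain v where v: "v \<in> U" "inf v x \<le> z" using \<open>z \<in> V\<close> by (auto simp: V_def)
      have "inf (inf u v) x = inf (inf u x) (inf v x)" by (simp add: inf_aci)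
      also have "\<dots> \<le> inf y z" using u(2) v(2) by (rule inf_mono)
      finally have "inf (inf u v) x \<le> inf y z" .
      moreover have "inf u v \<in> U" using u(1) v(1) U by (simp add: proper_filter_def)
      ultimately show ?thesis unfolding V_def by blast
    qed
    moreover have "\<forall>y\<in>V. \<forall>z. y \<le> z \<longrightarrow> z \<in> V" by (auto simp: V_def intro: order_trans)
    moreover have "top \<in> V" using U \<open>U \<subseteq> V\<close> by (auto simp: proper_filter_def)
    ultimately have "bot \<in> V" unfolding proper_filter_def by metis
    then obtain u where "u \<in> U" "inf u x = bot" by (auto simp: V_def bot_unique)
    then have "u \<le> - x" by (simp add: inf_shunt)
    then show ?thesis using \<open>u \<in> U\<close> U unfolding proper_filter_def by blast
  qed
  then show thesis using that U unfolding ultrafilter_def by blast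
qed

lemma finite_meet_empty [simp]: "finite_meet a {} = top"
  by (simp add: finite_meet_def)

lemma finite_meet_insert [simp]:
  assumes "finite I"
  shows "finite_meet a (insert i I) = inf (a i) (finite_meet a I)"
proof -
  have "insert top (a ` insert i I) = insert (a i) (insert top (a ` I))" by auto
  then show ?thesis using assms by (simp add: finite_meet_def)
qed

lemma finite_meet_union:
  assumes "finite I" "finite J"
  shows "finite_meet a (I \<union> J) = inf (finite_meet a I) (finite_meet a J)"
  using assms by (induction I) (auto simp: inf_assoc)

lemma finite_meet_in_ultrafilter_iff:
  assumes "finite I" "ultrafilter U"
  shows "finite_meet a I \<in> U \<longleftrightarrow> (\<forall>i\<in>I. a i \<in> U)"
  using assms by (induction I) (auto simp: ultrafilter_inf_iff ultrafilter_top)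

text \<open>This is the compactness of the Stone space.\<close>

lemma ultrafilter_compactness:
  fixes b :: "'i \<Rightarrow> 'a::boolean_algebra"
  assumes "\<And>J. finite J \<Longrightarrow> J \<subseteq> I \<Longrightarrow> finite_meet b J \<noteq> bot"
  shows "\<exists>U. ultrafilter U \<and> (\<forall>i\<in>I. b i \<in> U)"
proof -
  define F where "F = {x. \<exists>J. finite J \<and> J \<subseteq> I \<and> finite_meet b J \<le> x}"
  have "proper_filter F"
    unfolding proper_filter_def
  proof (intro conjI ballI allI impI)
    show "top \<in> F" by (auto simp: F_def intro: exI[of _ "{}"])
    show "bot \<notin> F" using assms by (auto simp: F_def bot_unique)
  next
    fix x y assume "x \<in> F" "y \<in> F"
    then obtain J K where "finite J" "J \<subseteq> I" "finite_meet b J \<le> x"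
        "finite K" "K \<subseteq> I" "finite_meet b K \<le> y" by (auto simp: F_def)
    then have "finite (J \<union> K)" "J \<union> K \<subseteq> I" "finite_meet b (J \<union> K) \<le> inf x y"
      by (auto simp: finite_meet_union intro: le_infI1 le_infI2)
    then show "inf x y \<in> F" unfolding F_def by blast
  next
    fix x y assume "x \<in> F" "x \<le> y"
    then show "y \<in> F" unfolding F_def by (blast intro: order_trans)
  qed
  then obtain U where U: "ultrafilter U" "F \<subseteq> U" by (rule proper_filter_extends_to_ultrafilter)
  have "b i \<in> F" if "i \<in> I" for i
    using that by (auto simp: F_def intro!: exI[of _ "{i}"])
  then show ?thesis using U by blast
qed

section \<open>Independence in terms of ultrafilters\<close>

text \<open>
  In topological terms, the map from the Stone space to \<open>{0,1}\<^sup>I\<close> given by the clopen sets \<open>a i\<close> is onto.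
  Finite meets only control finite patterns; compactness supplies the infinite ones. This form lets
  independence be transferred and refuted by choosing a pattern \<open>P\<close>.
\<close>

theorem independent_family_iff_ultrafilters:
  fixes a :: "'i \<Rightarrow> 'a::boolean_algebra"
  shows "independent_family a I \<longleftrightarrow> (\<forall>P. \<exists>U. ultrafilter U \<and> (\<forall>i\<in>I. a i \<in> U \<longleftrightarrow> i \<in> P))"
proof
  assume indep: "independent_family a I"
  show "\<forall>P. \<exists>U. ultrafilter U \<and> (\<forall>i\<in>I. a i \<in> U \<longleftrightarrow> i \<in> P)"
  proof
    fix P
    define b where "b = (\<lambda>i. if i \<in> P then a i else - a i)"
    have "finite_meet b J \<noteq> bot" if J: "finite J" "J \<subseteq> I" for J
    proof -
      have "finite_meet b J = inf (finite_meet b (J \<inter> P)) (finite_meet b (J - P))"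
        using J by (metis Int_Diff_Un finite_Diff finite_Int finite_meet_union)
      also have "finite_meet b (J \<inter> P) = finite_meet a (J \<inter> P)"
        unfolding finite_meet_def b_def by (intro arg_cong[of _ _ Inf_fin]) auto
      also have "finite_meet b (J - P) = finite_meet (\<lambda>i. - a i) (J - P)"
        unfolding finite_meet_def b_def by (intro arg_cong[of _ _ Inf_fin]) auto
      also have "inf (finite_meet a (J \<inter> P)) (finite_meet (\<lambda>i. - a i) (J - P)) \<noteq> bot"
        using indep[unfolded independent_family_def, rule_format, of "J \<inter> P" "J - P"] J by blast
      finally show ?thesis .
    qed
    then obtain U where U: "ultrafilter U" "\<And>i. i \<in> I \<Longrightarrow> b i \<in> U"
      using ultrafilter_compactness[of I b] by blast
    then have "a i \<in> U \<longleftrightarrow> i \<in> P" if "i \<in> I" for i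
      using U(2)[OF that] by (auto simp: b_def ultrafilter_compl_iff split: if_splits)
    then show "\<exists>U. ultrafilter U \<and> (\<forall>i\<in>I. a i \<in> U \<longleftrightarrow> i \<in> P)" using U by blast
  qed
next
  assume *: "\<forall>P. \<exists>U. ultrafilter U \<and> (\<forall>i\<in>I. a i \<in> U \<longleftrightarrow> i \<in> P)"
  show "independent_family a I"
    unfolding independent_family_def
  proof (intro allI impI)
    fix J K assume JK: "finite J \<and> finite K \<and> J \<subseteq> I \<and> K \<subseteq> I \<and> J \<inter> K = {}"
    obtain U where U: "ultrafilter U" "\<forall>i\<in>I. a i \<in> U \<longleftrightarrow> i \<in> J" using * by blast
    have "inf (finite_meet a J) (finite_meet (\<lambda>i. - a i) K) \<in> U"
      using JK U by (auto simp: ultrafilter_inf_iff finite_meet_in_ultrafilter_iff ultrafilter_compl_iff)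
    then show "inf (finite_meet a J) (finite_meet (\<lambda>i. - a i) K) \<noteq> bot"
      using ultrafilter_bot U by metis
  qed
qed

lemma independent_family_subset:
  "independent_family a I \<Longrightarrow> J \<subseteq> I \<Longrightarrow> independent_family a J"
  unfolding independent_family_def by (meson order_trans)

lemma independent_family_reindex:
  assumes "inj_on e I" "independent_family a (e ` I)"
  shows "independent_family (\<lambda>i. a (e i)) I"
  unfolding independent_family_iff_ultrafilters
proof
  fix P
  obtain U where "ultrafilter U" "\<forall>i\<in>e ` I. a i \<in> U \<longleftrightarrow> i \<in> e ` (P \<inter> I)"
    using assms(2) unfolding independent_family_iff_ultrafilters by blast
  moreover have "e i \<in> e ` (P \<inter> I) \<longleftrightarrow> i \<in> P" if "i \<in> I" for i
    using assms(1) that by (auto dest: inj_onD)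
  ultimately show "\<exists>U. ultrafilter U \<and> (\<forall>i\<in>I. a (e i) \<in> U \<longleftrightarrow> i \<in> P)" by auto
qed

section \<open>Rosenthal's dichotomy\<close>

text \<open>
  The number \<open>card (N \<inter> {..<i})\<close> is the position of \<open>i\<close> in the increasing enumeration of \<open>N\<close>, counted
  from \<open>0\<close>; this form treats finite and infinite \<open>N\<close> alike.
\<close>

definition alternates :: "(nat \<Rightarrow> 'a) \<Rightarrow> 'a set \<Rightarrow> nat set \<Rightarrow> bool" where
  "alternates a U N \<longleftrightarrow> (\<forall>i\<in>N. a i \<in> U \<longleftrightarrow> even (card (N \<inter> {..<i})))"

lemma alternates_initial_segment:
  assumes "alternates a U N"
  shows "alternates a U (N \<inter> {..<n})"
proof -
  have "N \<inter> {..<n} \<inter> {..<i} = N \<inter> {..<i}" if "i < n" for i using that by auto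
  then show ?thesis using assms by (auto simp: alternates_def)
qed

text \<open>
  Convergence at the points of the Stone space: the characteristic functions of the clopen sets given
  by \<open>a i\<close>, for \<open>i \<in> M\<close>, converge pointwise.
\<close>

definition pointwise_convergent :: "(nat \<Rightarrow> 'a::boolean_algebra) \<Rightarrow> nat set \<Rightarrow> bool" where
  "pointwise_convergent a M \<longleftrightarrow>
     (\<forall>U. ultrafilter U \<longrightarrow> finite {i\<in>M. a i \<in> U} \<or> finite {i\<in>M. a i \<notin> U})"

lemma pointwise_convergent_subset:
  assumes "pointwise_convergent a M" "N \<subseteq> M"
  shows "pointwise_convergent a N"
proof -
  have "{i\<in>N. p i} \<subseteq> {i\<in>M. p i}" for p using assms(2) by blast
  then show ?thesis using assms(1) unfolding pointwise_convergent_def by (meson finite_subset)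
qed

lemma card_range_below_strict_mono:
  assumes "strict_mono (e :: nat \<Rightarrow> nat)"
  shows "card (e ` S \<inter> {..<e k}) = card (S \<inter> {..<k})"
proof -
  have "e ` S \<inter> {..<e k} = e ` (S \<inter> {..<k})" using assms by (auto simp: strict_mono_less)
  then show ?thesis
    using assms by (simp add: card_image strict_mono_imp_inj_on)
qed

lemma alternation_if_not_convergent:
  assumes "infinite {i\<in>M. a i \<in> U}" "infinite {i\<in>M. a i \<notin> U}"
  obtains N where "N \<subseteq> M" "infinite N" "alternates a U N"
proof -
  have next_elem: "\<exists>j>i. j \<in> M \<and> (a j \<in> U \<longleftrightarrow> c)" for i :: nat and c
    using assms by (cases c) (auto simp: infinite_nat_iff_unbounded)
  have "\<exists>e. \<forall>n. (e n \<in> M \<and> (a (e n) \<in> U \<longleftrightarrow> even n)) \<and> e n < e (Suc n)"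
  proof (rule dependent_nat_choice)
    show "\<exists>x. x \<in> M \<and> (a x \<in> U \<longleftrightarrow> even 0)" using next_elem[of 0 True] by auto
    show "\<exists>y. (y \<in> M \<and> (a y \<in> U \<longleftrightarrow> even (Suc n))) \<and> x < y" for x n
      using next_elem[of x "even (Suc n)"] by auto
  qed
  then obtain e :: "nat \<Rightarrow> nat"
    where e: "\<And>n. e n \<in> M" "\<And>n. a (e n) \<in> U \<longleftrightarrow> even n" "strict_mono e"
    unfolding strict_mono_Suc_iff by blast
  have "infinite (range e)" using e(3) by (simp add: range_inj_infinite strict_mono_imp_inj_on)
  moreover have "alternates a U (range e)"
    using e(2) card_range_below_strict_mono[OF e(3), of UNIV] by (auto simp: alternates_def)
  ultimately show thesis using that[of "range e"] e(1) by blast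
qed

text \<open>
  If every set of indices admits an alternating ultrafilter, then the odd indices are independent:
  the even indices serve as switches that can be inserted to correct the parity before each odd
  index, so that the alternation realises any prescribed pattern there.
\<close>

lemma independent_if_alternating:
  fixes c :: "nat \<Rightarrow> 'a::boolean_algebra"
  assumes "\<And>N. \<exists>U. ultrafilter U \<and> alternates c U N"
  shows "independent_family (\<lambda>k. c (2 * k + 1)) UNIV"
  unfolding independent_family_iff_ultrafilters
proof
  fix P :: "nat set"
  define switch where
    "switch = (\<lambda>k. case k of 0 \<Rightarrow> 0 \<notin> P | Suc j \<Rightarrow> Suc j \<in> P \<longleftrightarrow> j \<in> P)"
  define N where "N = {n. odd n \<or> switch (n div 2)}"
  have parity: "even (card (N \<inter> {..<2 * k + 1})) \<longleftrightarrow> k \<in> P" for k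
  proof (induction k)
    case 0
    have "N \<inter> {..<2 * 0 + 1} = (if switch 0 then {0} else {})" by (auto simp: N_def)
    then show ?case by (auto simp: switch_def)
  next
    case (Suc k)
    let ?S = "N \<inter> {..<2 * k + 1}"
    have "N \<inter> {..<2 * Suc k + 1} =
        insert (2 * k + 1) (if switch (Suc k) then insert (2 * k + 2) ?S else ?S)"
      by (auto simp: N_def less_Suc_eq)
    then have "card (N \<inter> {..<2 * Suc k + 1}) = card ?S + (if switch (Suc k) then 2 else 1)"
      by auto
    then show ?case using Suc by (auto simp: switch_def)
  qed
  obtain U where U: "ultrafilter U" "alternates c U N" using assms by blast
  have "2 * k + 1 \<in> N" for k by (simp add: N_def)
  then have "c (2 * k + 1) \<in> U \<longleftrightarrow> k \<in> P" for k
    using U(2) parity[of k] unfolding alternates_def by blast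
  then show "\<exists>U. ultrafilter U \<and> (\<forall>i\<in>UNIV. c (2 * i + 1) \<in> U \<longleftrightarrow> i \<in> P)" using U by blast
qed

text \<open>
  In \<open>ramsey_open\<close>, let \<open>F\<close> consist of the sets along which no ultrafilter alternates. If no finite
  subset of \<open>M\<close> is in \<open>F\<close>, compactness gives an alternating ultrafilter for every subset of \<open>M\<close>, and
  the sequence is independent along every other element of \<open>M\<close>. If every infinite subset of \<open>M\<close> has
  an initial segment in \<open>F\<close>, no ultrafilter can alternate along an infinite subset of \<open>M\<close>, which
  forces convergence.
\<close>

theorem rosenthal_dichotomy:
  fixes a :: "nat \<Rightarrow> 'a::boolean_algebra"
  assumes "infinite M0"
  obtains e :: "nat \<Rightarrow> nat" where "independent_family (\<lambda>k. a (e k)) UNIV"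
  | M where "M \<subseteq> M0" "infinite M" "pointwise_convergent a M"
proof -
  define F where "F = {s. \<nexists>U. ultrafilter U \<and> alternates a U s}"
  show thesis
  proof (rule ramsey_open[OF assms, of F])
    fix M assume M: "M \<subseteq> M0" "infinite M" and "\<And>s. s \<subseteq> M \<Longrightarrow> finite s \<Longrightarrow> s \<notin> F"
    then have alt: "\<exists>U. ultrafilter U \<and> alternates a U s" if "s \<subseteq> M" "finite s" for s
      using that by (auto simp: F_def)
    have alt_inf: "\<exists>U. ultrafilter U \<and> alternates a U N" if "N \<subseteq> M" for N
    proof -
      define b where "b = (\<lambda>i. if even (card (N \<inter> {..<i})) then a i else - a i)"
      have "finite_meet b J \<noteq> bot" if J: "finite J" "J \<subseteq> N" for J
      proof -
        obtain n where n: "J \<subseteq> {..<n}"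
          using J(1) finite_nat_iff_bounded by auto
        obtain U where U: "ultrafilter U" "alternates a U (N \<inter> {..<n})"
          using alt[of "N \<inter> {..<n}"] \<open>N \<subseteq> M\<close> by auto
        have "b i \<in> U" if "i \<in> J" for i
        proof -
          have "N \<inter> {..<n} \<inter> {..<i} = N \<inter> {..<i}" using n that by auto
          then have "a i \<in> U \<longleftrightarrow> even (card (N \<inter> {..<i}))"
            using U(2) that J n unfolding alternates_def by (metis IntI subsetD)
          then show ?thesis using U(1) by (simp add: b_def ultrafilter_compl_iff)
        qed
        then have "finite_meet b J \<in> U" using J U by (simp add: finite_meet_in_ultrafilter_iff)
        then show ?thesis using ultrafilter_bot U by metis
      qed
      then obtain U where U: "ultrafilter U" "\<And>i. i \<in> N \<Longrightarrow> b i \<in> U"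
        using ultrafilter_compactness[of N b] by blast
      have "alternates a U N"
        unfolding alternates_def
      proof
        fix i assume "i \<in> N"
        then show "a i \<in> U \<longleftrightarrow> even (card (N \<inter> {..<i}))"
          using U(2)[of i] U(1) by (auto simp: b_def ultrafilter_compl_iff split: if_splits)
      qed
      then show ?thesis using U by blast
    qed
    define e where "e = enumerate M"
    have e: "strict_mono e" "range e = M"
      using M by (auto simp: e_def strict_mono_enumerate range_enumerate)
    have "\<exists>U. ultrafilter U \<and> alternates (\<lambda>k. a (e k)) U N" for N
    proof -
      obtain U where U: "ultrafilter U" "alternates a U (e ` N)" using alt_inf[of "e ` N"] e by auto
      then have "alternates (\<lambda>k. a (e k)) U N"
        using card_range_below_strict_mono[OF e(1), of N] by (auto simp: alternates_def)
      then show ?thesis using U by blast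
    qed
    then have "independent_family (\<lambda>k. a (e (2 * k + 1))) UNIV" by (rule independent_if_alternating)
    then show thesis by (rule that(1))
  next
    fix M assume M: "M \<subseteq> M0" "infinite M"
      and initial: "\<And>N. N \<subseteq> M \<Longrightarrow> infinite N \<Longrightarrow> \<exists>n. N \<inter> {..<n} \<in> F"
    have "pointwise_convergent a M"
      unfolding pointwise_convergent_def
    proof (intro allI impI, rule ccontr)
      fix U assume U: "ultrafilter U"
        and "\<not> (finite {i\<in>M. a i \<in> U} \<or> finite {i\<in>M. a i \<notin> U})"
      then obtain N where "N \<subseteq> M" "infinite N" "alternates a U N"
        using alternation_if_not_convergent[of M a U] by blast
      then show False using initial alternates_initial_segment U unfolding F_def by blast
    qed
    then show thesis using that(2) M by blast
  qed
qed

section \<open>Families without independent sequences\<close>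

definition independence_free :: "'a::boolean_algebra set \<Rightarrow> bool" where
  "independence_free S \<longleftrightarrow> \<not> (\<exists>a :: nat \<Rightarrow> 'a. range a \<subseteq> S \<and> independent_family a UNIV)"

lemma independence_free_subset: "independence_free S \<Longrightarrow> T \<subseteq> S \<Longrightarrow> independence_free T"
  unfolding independence_free_def by blast

lemma independence_free_bot: "independence_free {bot}"
  unfolding independence_free_def
proof safe
  fix a :: "nat \<Rightarrow> 'a" assume a: "range a \<subseteq> {bot}" "independent_family a UNIV"
  then obtain U where "ultrafilter U" "a 0 \<in> U"
    unfolding independent_family_iff_ultrafilters by blast
  moreover have "a 0 = bot" using a(1) by blast
  ultimately show False using ultrafilter_bot by metis
qed

lemma independence_free_Un:
  assumes "independence_free S" "independence_free T"
  shows "independence_free (S \<union> T)"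
  unfolding independence_free_def
proof safe
  fix a :: "nat \<Rightarrow> 'a" assume a: "range a \<subseteq> S \<union> T" and indep: "independent_family a UNIV"
  have finite_part: "finite {i. a i \<in> R}" if "independence_free R" for R
  proof (rule ccontr)
    define e where "e = enumerate {i. a i \<in> R}"
    assume inf: "infinite {i. a i \<in> R}"
    then have "inj e" by (simp add: e_def strict_mono_enumerate strict_mono_imp_inj_on)
    moreover have "independent_family a (range e)"
      using indep by (rule independent_family_subset) simp
    ultimately have "independent_family (\<lambda>k. a (e k)) UNIV"
      by (rule independent_family_reindex)
    moreover have "range (\<lambda>k. a (e k)) \<subseteq> R"
      using enumerate_in_set[OF inf] by (auto simp: e_def)
    ultimately show False using that unfolding independence_free_def by blast
  qed
  have "UNIV = {i. a i \<in> S} \<union> {i. a i \<in> T}" using a by blast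
  then have "finite (UNIV :: nat set)" using finite_part assms by (metis finite_Un)
  then show False by simp
qed

lemma independence_free_uminus:
  assumes "independence_free S"
  shows "independence_free (uminus ` S)"
  unfolding independence_free_def
proof safe
  fix a :: "nat \<Rightarrow> 'a" assume a: "range a \<subseteq> uminus ` S" and indep: "independent_family a UNIV"
  have "independent_family (\<lambda>i. - a i) UNIV"
    unfolding independent_family_iff_ultrafilters
  proof
    fix P
    obtain U where "ultrafilter U" "\<forall>i\<in>UNIV. a i \<in> U \<longleftrightarrow> i \<in> - P"
      using indep unfolding independent_family_iff_ultrafilters by blast
    then show "\<exists>U. ultrafilter U \<and> (\<forall>i\<in>UNIV. - a i \<in> U \<longleftrightarrow> i \<in> P)"
      by (auto simp: ultrafilter_compl_iff)
  qed
  moreover have "range (\<lambda>i. - a i) \<subseteq> S" using a by fastforce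
  ultimately show False using assms unfolding independence_free_def by blast
qed

lemma independence_free_convergent_subsequence:
  assumes "independence_free S" "range a \<subseteq> S" "infinite M"
  obtains N where "N \<subseteq> M" "infinite N" "pointwise_convergent a N"
proof (rule rosenthal_dichotomy[OF assms(3), of a])
  fix e :: "nat \<Rightarrow> nat" assume "independent_family (\<lambda>k. a (e k)) UNIV"
  moreover have "range (\<lambda>k. a (e k)) \<subseteq> S" using assms(2) by blast
  ultimately show thesis using assms(1) unfolding independence_free_def by blast
qed (rule that)

lemma pointwise_convergent_inf:
  assumes "pointwise_convergent s M" "pointwise_convergent t M"
  shows "pointwise_convergent (\<lambda>i. inf (s i) (t i)) M"
  unfolding pointwise_convergent_def
proof (intro allI impI)
  fix U :: "'a set" assume U: "ultrafilter U"
  have *: "{i\<in>M. inf (s i) (t i) \<in> U} = {i\<in>M. s i \<in> U} \<inter> {i\<in>M. t i \<in> U}"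
    "{i\<in>M. inf (s i) (t i) \<notin> U} = {i\<in>M. s i \<notin> U} \<union> {i\<in>M. t i \<notin> U}"
    using ultrafilter_inf_iff[OF U] by auto
  show "finite {i\<in>M. inf (s i) (t i) \<in> U} \<or> finite {i\<in>M. inf (s i) (t i) \<notin> U}"
    using assms U unfolding * pointwise_convergent_def by blast
qed

text \<open>An ultrafilter containing exactly every other term of the sequence witnesses divergence.\<close>

lemma independent_not_pointwise_convergent:
  assumes "independent_family a UNIV" "infinite M"
  shows "\<not> pointwise_convergent a M"
proof
  assume conv: "pointwise_convergent a M"
  define e where "e = enumerate M"
  have e: "inj e" "\<And>k. e k \<in> M"
    using assms(2) by (auto simp: e_def strict_mono_enumerate strict_mono_imp_inj_on enumerate_in_set)
  obtain U where U: "ultrafilter U" "\<forall>i\<in>UNIV. a i \<in> U \<longleftrightarrow> i \<in> e ` {k. even k}"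
    using assms(1) unfolding independent_family_iff_ultrafilters by blast
  have "range (\<lambda>k. e (2 * k)) \<subseteq> {i\<in>M. a i \<in> U}" using U(2) e by auto
  moreover have "range (\<lambda>k. e (2 * k + 1)) \<subseteq> {i\<in>M. a i \<notin> U}"
    using U(2) e by (auto dest: injD)
  moreover have "infinite (range (\<lambda>k. e (2 * k)))" "infinite (range (\<lambda>k. e (2 * k + 1)))"
    using e(1) by (auto intro!: range_inj_infinite injI dest!: injD)
  ultimately show False
    using conv U(1) unfolding pointwise_convergent_def by (meson finite_subset)
qed

text \<open>
  Neither factor need inherit independence from the meets, but the meets inherit convergence from the
  factors; the dichotomy is what allows this change of viewpoint.
\<close>

lemma independence_free_inf:
  assumes "independence_free S" "independence_free T"
  shows "independence_free ((\<lambda>(x, y). inf x y) ` (S \<times> T))"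
  unfolding independence_free_def
proof safe
  fix a :: "nat \<Rightarrow> 'a"
  assume a: "range a \<subseteq> (\<lambda>(x, y). inf x y) ` (S \<times> T)" and indep: "independent_family a UNIV"
  have "\<forall>i. \<exists>x y. x \<in> S \<and> y \<in> T \<and> a i = inf x y" using a by fastforce
  then obtain s t where st: "range s \<subseteq> S" "range t \<subseteq> T" "\<And>i. a i = inf (s i) (t i)"
    by (metis image_subsetI)
  obtain M where M: "infinite M" "pointwise_convergent s M"
    using independence_free_convergent_subsequence[OF assms(1) st(1) infinite_UNIV_nat] by blast
  obtain N where N: "N \<subseteq> M" "infinite N" "pointwise_convergent t N"
    using independence_free_convergent_subsequence[OF assms(2) st(2) M(1)] by blast
  have "pointwise_convergent (\<lambda>i. inf (s i) (t i)) N"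
    using pointwise_convergent_subset[OF M(2) N(1)] N(3) by (rule pointwise_convergent_inf)
  then have "pointwise_convergent a N" using st(3) by presburger
  then show False using independent_not_pointwise_convergent[OF indep N(2)] by blast
qed

section \<open>Weakly Radon-Nikodym algebras\<close>

text \<open>
  These stages exhaust the generated subalgebra. Each arises from the previous one by finitely many
  operations that preserve \<open>independence_free\<close>, which is why only one new family enters at a time.
\<close>

primrec generation_stage :: "(nat \<Rightarrow> 'a::boolean_algebra set) \<Rightarrow> nat \<Rightarrow> 'a set" where
  "generation_stage Gs 0 = {bot}"
| "generation_stage Gs (Suc n) = generation_stage Gs n \<union> Gs n \<union> uminus ` generation_stage Gs n \<union>
     (\<lambda>(x, y). inf x y) ` (generation_stage Gs n \<times> generation_stage Gs n)"

lemma generation_stage_mono: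
  assumes "m \<le> n"
  shows "generation_stage Gs m \<subseteq> generation_stage Gs n"
proof -
  have "generation_stage Gs n \<subseteq> generation_stage Gs (Suc n)" for n
    unfolding generation_stage.simps by blast
  then show ?thesis using assms by (rule lift_Suc_mono_le)
qed

lemma independence_free_generation_stage:
  assumes "\<And>n. independence_free (Gs n)"
  shows "independence_free (generation_stage Gs n)"
proof (induction n)
  case (Suc n)
  then show ?case
    unfolding generation_stage.simps
    by (intro assms independence_free_Un independence_free_inf independence_free_uminus)
qed (simp add: independence_free_bot)

lemma boolean_subalgebra_generation_stages:
  "boolean_subalgebra (\<Union>n. generation_stage Gs n)" (is "boolean_subalgebra ?L")
proof -
  have stage: "generation_stage Gs n \<subseteq> ?L" for n by (rule UN_upper) simp
  have bot: "bot \<in> ?L" using stage[of 0] by simp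
  have compl: "- x \<in> ?L" if "x \<in> ?L" for x
  proof -
    obtain n where "x \<in> generation_stage Gs n" using \<open>x \<in> ?L\<close> by blast
    then have "- x \<in> generation_stage Gs (Suc n)" by simp
    then show ?thesis using stage by blast
  qed
  have meet: "inf x y \<in> ?L" if xy: "x \<in> ?L" "y \<in> ?L" for x y
  proof -
    obtain m n where "x \<in> generation_stage Gs m" "y \<in> generation_stage Gs n" using xy by blast
    then have "x \<in> generation_stage Gs (max m n)" "y \<in> generation_stage Gs (max m n)"
      using generation_stage_mono[of _ "max m n" Gs] by (meson max.cobounded1 max.cobounded2 subsetD)+
    then have "inf x y \<in> generation_stage Gs (Suc (max m n))" by force
    then show ?thesis using stage by blast
  qed
  have top: "top \<in> ?L" using compl[OF bot] by simp
  have join: "sup x y \<in> ?L" if "x \<in> ?L" "y \<in> ?L" for x y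
    using compl[OF meet[OF compl compl]] that by simp
  show ?thesis unfolding boolean_subalgebra_def by (intro conjI ballI bot top compl meet join)
qed

lemma weakly_radon_nikodym_covering:
  assumes "weakly_radon_nikodym A"
  obtains L :: "nat \<Rightarrow> 'a::boolean_algebra set"
  where "A \<subseteq> (\<Union>n. L n)" "\<And>n. independence_free (L n)"
proof -
  obtain Gs :: "nat \<Rightarrow> 'a set" where hull: "boolean_subalgebra hull (\<Union>n. Gs n) = A"
    and free: "\<And>n. independence_free (Gs n)"
    using assms unfolding weakly_radon_nikodym_def independence_free_def by blast
  have "Gs n \<subseteq> (\<Union>n. generation_stage Gs n)" for n
  proof -
    have "Gs n \<subseteq> generation_stage Gs (Suc n)" unfolding generation_stage.simps by blast
    then show ?thesis by blast
  qed
  then have "(\<Union>n. Gs n) \<subseteq> (\<Union>n. generation_stage Gs n)" by (rule UN_least)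
  then have "boolean_subalgebra hull (\<Union>n. Gs n) \<subseteq> (\<Union>n. generation_stage Gs n)"
    using boolean_subalgebra_generation_stages by (rule hull_minimal)
  then show thesis
    unfolding hull using independence_free_generation_stage[OF free] by (rule that)
qed

theorem corollary3p3:
  fixes A B :: "'a::boolean_algebra set"
  assumes "boolean_subalgebra A"
    and "weakly_radon_nikodym A"
    and "boolean_subalgebra B"
    and "B \<subseteq> A"
  shows "weakly_radon_nikodym B"
proof -
  obtain L :: "nat \<Rightarrow> 'a set" where L: "A \<subseteq> (\<Union>n. L n)" "\<And>n. independence_free (L n)"
    using weakly_radon_nikodym_covering[OF assms(2)] by blast
  have union: "B = (\<Union>n. B \<inter> L n)" using L(1) assms(4) by blast
  have free: "independence_free (B \<inter> L n)" for n
    using independence_free_subset[OF L(2)] by blast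
  have "boolean_subalgebra hull B = B" using assms(3) by (rule hull_same)
  then show ?thesis
    unfolding weakly_radon_nikodym_def independence_free_def[symmetric]
    by (intro exI[of _ B] exI[of _ "\<lambda>n. B \<inter> L n"] conjI allI order_refl union free)
qed

end
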